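(* Let $M = \mathrm{Emb}(\mathbb{Q},\le)$ be the monoid of self-embeddings of the linear order $(\mathbb{Q},\le)$. Then $M$ has automatic homeomorphicity: for every countable set $\Omega$ and every closed submonoid $M'$ of the full transformation monoid $\mathrm{Tr}(\Omega)$, every monoid isomorphism $\theta\colon M\to M'$ is a homeomorphism.
   Context: $\mathrm{Tr}(\Omega)$ is the monoid of all maps $\Omega\to\Omega$ under composition. It is topologized by taking as sub-basic open sets all sets $\{f\in \mathrm{Tr}(\Omega)\colon f(x)=y\}$ with $x,y\in\Omega$ (pointwise convergence, $\Omega$ discrete); submonoids carry the subspace topology. Likewise $M\subseteq \mathrm{Tr}(\mathbb{Q})$ carries the subspace topology. Since the order is linear, $M$ is the set of all strictly order-preserving maps $\mathbb{Q}\to\mathbb{Q}$, i.e. $M=\mathrm{End}(\mathbb{Q},<)$. *)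

theory Defs
  imports "HOL-Analysis.Analysis" "HOL-Algebra.Group"
begin

text \<open>
  A self-map of a set \<open>\<Omega>\<close> is represented by an extensional function, i.e. one that takes the
  value \<^term>\<open>undefined\<close> outside \<open>\<Omega>\<close>, so that maps that agree on \<open>\<Omega>\<close> are equal.
  For \<open>\<Omega> = UNIV\<close> this is no restriction.
\<close>

definition Tr :: "'a set \<Rightarrow> ('a \<Rightarrow> 'a) monoid" where
  "Tr \<Omega> = \<lparr>carrier = \<Omega> \<rightarrow>\<^sub>E \<Omega>, mult = compose \<Omega>, one = (\<lambda>x\<in>\<Omega>. x)\<rparr>"

text \<open>
  The whole space is listed among the generators because \<open>topology_generated_by\<close> takes the
  union of the generators as the underlying space; for \<open>\<Omega> = {}\<close> the other generators
  would not cover the one-element set \<open>carrier (Tr {})\<close>.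
\<close>

definition Tr_topology :: "'a set \<Rightarrow> ('a \<Rightarrow> 'a) topology" where
  "Tr_topology \<Omega> = topology_generated_by
     (insert (carrier (Tr \<Omega>)) {{f \<in> carrier (Tr \<Omega>). f x = y} | x y. x \<in> \<Omega> \<and> y \<in> \<Omega>})"

definition Emb_rat_le :: "(rat \<Rightarrow> rat) set" where
  "Emb_rat_le = {f. inj f \<and> (\<forall>x y. x \<le> y \<longleftrightarrow> f x \<le> f y)}"

lemma monoid_Tr: "monoid (Tr \<Omega>)"
proof (rule monoidI)
  fix f g h assume "f \<in> carrier (Tr \<Omega>)" "g \<in> carrier (Tr \<Omega>)" "h \<in> carrier (Tr \<Omega>)"
  then show "f \<otimes>\<^bsub>Tr \<Omega>\<^esub> g \<otimes>\<^bsub>Tr \<Omega>\<^esub> h = f \<otimes>\<^bsub>Tr \<Omega>\<^esub> (g \<otimes>\<^bsub>Tr \<Omega>\<^esub> h)"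
    by (simp add: Tr_def PiE_def compose_assoc[symmetric])
qed (auto simp: Tr_def PiE_def compose_def restrict_def extensional_def fun_eq_iff)

lemma topspace_Tr_topology: "topspace (Tr_topology \<Omega>) = carrier (Tr \<Omega>)"
  by (auto simp: Tr_topology_def)

lemma Tr_topology_eq_product_topology:
  "Tr_topology \<Omega> = product_topology (\<lambda>_. discrete_topology \<Omega>) \<Omega>"
proof -
  let ?P = "product_topology (\<lambda>_. discrete_topology \<Omega>) \<Omega>"
  have carr: "carrier (Tr \<Omega>) = (\<Omega> \<rightarrow>\<^sub>E \<Omega>)" by (simp add: Tr_def)
  have "openin (Tr_topology \<Omega>) U" if U: "openin ?P U" for U
  proof (subst openin_subopen, intro ballI)
    fix f assume "f \<in> U"
    with U obtain B where fB: "f \<in> (\<Pi>\<^sub>E i\<in>\<Omega>. B i)" and BU: "(\<Pi>\<^sub>E i\<in>\<Omega>. B i) \<subseteq> U"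
      and fin: "finite {i \<in> \<Omega>. B i \<noteq> \<Omega>}" and B: "\<And>i. i \<in> \<Omega> \<Longrightarrow> B i \<subseteq> \<Omega>"
      by (auto simp: openin_product_topology_alt)
    define S where "S x = {g \<in> carrier (Tr \<Omega>). g x = f x}" for x
    let ?V = "\<Inter>(insert (carrier (Tr \<Omega>)) (S ` {i \<in> \<Omega>. B i \<noteq> \<Omega>}))"
    have fC: "f \<in> carrier (Tr \<Omega>)" using fB B by (auto simp: carr PiE_iff)
    have "openin (Tr_topology \<Omega>) (S x)" if "x \<in> \<Omega>" for x
      unfolding Tr_topology_def
      by (rule topology_generated_by_Basis) (use that fC in \<open>auto simp: S_def carr PiE_iff\<close>)
    moreover have "openin (Tr_topology \<Omega>) (carrier (Tr \<Omega>))"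
      by (metis openin_topspace topspace_Tr_topology)
    ultimately have "openin (Tr_topology \<Omega>) ?V"
      using fin by (intro openin_Inter) auto
    moreover have "f \<in> ?V" using fC by (auto simp: S_def)
    moreover have "?V \<subseteq> U"
    proof
      fix g assume g: "g \<in> ?V"
      have "g i \<in> B i" if "i \<in> \<Omega>" for i
      proof (cases "B i = \<Omega>")
        case True then show ?thesis using g that by (auto simp: carr PiE_iff)
      next
        case False
        then have "g i = f i" using g that by (auto simp: S_def)
        then show ?thesis using fB that by (auto simp: PiE_iff)
      qed
      then have "g \<in> (\<Pi>\<^sub>E i\<in>\<Omega>. B i)" using g by (auto simp: carr PiE_iff)
      then show "g \<in> U" using BU by blast
    qed
    ultimately show "\<exists>T. openin (Tr_topology \<Omega>) T \<and> f \<in> T \<and> T \<subseteq> U" by blast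
  qed
  moreover have "openin ?P U" if U: "openin (Tr_topology \<Omega>) U" for U
  proof -
    have gen: "openin ?P W"
      if W: "W \<in> insert (carrier (Tr \<Omega>)) {{f \<in> carrier (Tr \<Omega>). f x = y} | x y. x \<in> \<Omega> \<and> y \<in> \<Omega>}"
      for W
    proof (cases "W = carrier (Tr \<Omega>)")
      case True
      then have "W = topspace ?P" by (simp add: carr)
      then show ?thesis by (simp only: openin_topspace)
    next
      case False
      with W obtain x y where xy: "x \<in> \<Omega>" "y \<in> \<Omega>" and "W = {f \<in> carrier (Tr \<Omega>). f x = y}"
        by auto
      then have "W = {f \<in> topspace ?P. f x \<in> {y}}" by (auto simp: carr)
      moreover have "continuous_map ?P (discrete_topology \<Omega>) (\<lambda>f. f x)"
        using xy by (intro continuous_map_product_projection)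
      ultimately show ?thesis
        using xy openin_continuous_map_preimage[of ?P "discrete_topology \<Omega>" "\<lambda>f. f x" "{y}"] by simp
    qed
    have "generate_topology_on
        (insert (carrier (Tr \<Omega>)) {{f \<in> carrier (Tr \<Omega>). f x = y} | x y. x \<in> \<Omega> \<and> y \<in> \<Omega>}) U"
      using U unfolding Tr_topology_def openin_topology_generated_by_iff .
    then show ?thesis
      by induction (use gen in auto)
  qed
  ultimately show ?thesis by (auto simp: topology_eq)
qed

lemma Emb_rat_le_eq_strict_mono: "Emb_rat_le = {f. strict_mono f}"
proof -
  have "strict_mono f" if "inj f" "\<forall>x y. x \<le> y \<longleftrightarrow> f x \<le> f y" for f :: "rat \<Rightarrow> rat"
    using that by (meson not_le strict_monoI)
  then show ?thesis
    by (auto simp: Emb_rat_le_def strict_mono_less_eq strict_mono_imp_inj_on)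
qed

lemma submonoid_Emb_rat_le: "submonoid Emb_rat_le (Tr UNIV)"
  by (rule submonoid.intro) (auto simp: Emb_rat_le_eq_strict_mono Tr_def compose_def strict_mono_def)

end

theory Submission
  imports Defs
begin

text \<open>
  Write \<open>M\<close> for the monoid of strictly increasing maps of the rationals and \<open>G\<close> for its group of
  units, the increasing bijections. An isomorphism \<open>\<theta>\<close> onto \<open>M'\<close> is a faithful action of \<open>M\<close> on the
  countable set \<open>\<Omega>\<close> by a pointwise closed set of maps.

  The inverse of \<open>\<theta>\<close> is continuous for purely algebraic reasons. Inequations such as
  \<open>p \<circ> f \<circ> u \<noteq> q \<circ> f \<circ> u\<close>, with \<open>p\<close>, \<open>q\<close>, \<open>u\<close> in \<open>M\<close>, are preserved by \<open>\<theta>\<close>, and a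
  difference between two maps of \<open>\<Omega>\<close> is visible at a single point, so they define sets of \<open>f\<close>
  whose images are open in \<open>M'\<close>. If \<open>p\<close> and \<open>q\<close> differ exactly at \<open>y\<close>, the
  inequation says that \<open>y\<close> lies in the image of the range of \<open>u\<close> under \<open>f\<close>. Two such
  conditions, for maps \<open>u\<close>, \<open>v\<close> whose ranges meet only in \<open>x\<close>, together say \<open>f x = y\<close>
  (\<open>inverse_continuous_at_point\<close>). Since \<open>M'\<close> is closed, it follows that \<open>\<theta>\<close> has a closed graph
  (\<open>closed_graph\<close>): if maps \<open>v\<close> in \<open>M\<close> converge to \<open>g\<close> in \<open>M\<close> while the maps \<open>\<theta> v\<close> converge to \<open>s\<close>,
  then \<open>s = \<theta> g\<close>.

  Continuity of \<open>\<theta>\<close> on \<open>G\<close> is then an open mapping argument. The elements of \<open>G\<close> that fix a finite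
  subset of \<open>\<Omega>\<close> form a subgroup of countable index; as \<open>G\<close> is a Baire space, the closure of this
  subgroup contains every element of \<open>G\<close> that fixes a certain finite set of rationals
  (\<open>stabiliser_dense_in_pointwise_stabiliser\<close>). Successive approximation together with the
  closed graph turns this density into equality: the stabiliser of each point of \<open>\<Omega>\<close> contains the
  pointwise stabiliser of a finite set of rationals (\<open>pointwise_stabiliser_fixes\<close>).

  Finally \<open>G\<close> is dense in \<open>M\<close>, because a finite increasing map extends to a piecewise linear
  bijection. For \<open>f\<close> in \<open>M\<close>, elements of \<open>G\<close> converging to \<open>f\<close> have \<open>\<theta>\<close>-images that
  converge by the continuity on \<open>G\<close>, and the closed graph identifies the limit as \<open>\<theta> f\<close>
  (\<open>continuous_at_point\<close>).
\<close>

section \<open>Open sets of maps\<close>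

lemma openin_Tr_topology_iff:
  "openin (Tr_topology \<Omega>) U \<longleftrightarrow> U \<subseteq> carrier (Tr \<Omega>) \<and>
     (\<forall>f\<in>U. \<exists>F. finite F \<and> F \<subseteq> \<Omega> \<and> {g \<in> carrier (Tr \<Omega>). \<forall>x\<in>F. g x = f x} \<subseteq> U)"
  (is "?L \<longleftrightarrow> ?R")
proof
  assume ?L
  show ?R
  proof (intro conjI ballI)
    show "U \<subseteq> carrier (Tr \<Omega>)"
      using \<open>?L\<close> openin_subset topspace_Tr_topology by blast
    fix f assume "f \<in> U"
    with \<open>?L\<close> obtain B where B: "finite {i \<in> \<Omega>. B i \<noteq> \<Omega>}" "f \<in> (\<Pi>\<^sub>E i\<in>\<Omega>. B i)"
        "(\<Pi>\<^sub>E i\<in>\<Omega>. B i) \<subseteq> U"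
      by (auto simp: Tr_topology_eq_product_topology openin_product_topology_alt)
    have "{g \<in> carrier (Tr \<Omega>). \<forall>x\<in>{i \<in> \<Omega>. B i \<noteq> \<Omega>}. g x = f x} \<subseteq> (\<Pi>\<^sub>E i\<in>\<Omega>. B i)"
    proof clarify
      fix g assume g: "g \<in> carrier (Tr \<Omega>)" "\<forall>x\<in>{i \<in> \<Omega>. B i \<noteq> \<Omega>}. g x = f x"
      have "g x \<in> B x" if "x \<in> \<Omega>" for x
        using g B(2) that by (cases "B x = \<Omega>") (auto simp: Tr_def PiE_iff)
      then show "g \<in> (\<Pi>\<^sub>E i\<in>\<Omega>. B i)"
        using g by (auto simp: Tr_def PiE_iff)
    qed
    then show "\<exists>F. finite F \<and> F \<subseteq> \<Omega> \<and> {g \<in> carrier (Tr \<Omega>). \<forall>x\<in>F. g x = f x} \<subseteq> U"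
      using B by (intro exI[of _ "{i \<in> \<Omega>. B i \<noteq> \<Omega>}"]) auto
  qed
next
  assume R: ?R
  show ?L
  proof (subst openin_subopen, intro ballI)
    fix f assume f: "f \<in> U"
    with R obtain F where F: "finite F" "F \<subseteq> \<Omega>"
        "{g \<in> carrier (Tr \<Omega>). \<forall>x\<in>F. g x = f x} \<subseteq> U"
      by blast
    have fC: "f \<in> carrier (Tr \<Omega>)" using R f by blast
    let ?V = "\<Inter>(insert (carrier (Tr \<Omega>)) ((\<lambda>x. {g \<in> carrier (Tr \<Omega>). g x = f x}) ` F))"
    have "openin (Tr_topology \<Omega>) {g \<in> carrier (Tr \<Omega>). g x = f x}" if "x \<in> F" for x
      unfolding Tr_topology_def
      by (rule topology_generated_by_Basis) (use that F(2) fC in \<open>auto simp: Tr_def PiE_iff\<close>)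
    moreover have "openin (Tr_topology \<Omega>) (carrier (Tr \<Omega>))"
      by (metis openin_topspace topspace_Tr_topology)
    ultimately have "openin (Tr_topology \<Omega>) ?V"
      using F(1) by (intro openin_Inter) auto
    moreover have "f \<in> ?V" using fC by simp
    moreover have "?V \<subseteq> U" using F(3) by blast
    ultimately show "\<exists>T. openin (Tr_topology \<Omega>) T \<and> f \<in> T \<and> T \<subseteq> U" by blast
  qed
qed

text \<open>
  Membership in a relatively open set is decided by finitely many values; all topology in the
  main argument is reduced to this finitary form.
\<close>

lemma openin_subtopology_Tr_iff:
  assumes "S \<subseteq> carrier (Tr \<Omega>)"
  shows "openin (subtopology (Tr_topology \<Omega>) S) U \<longleftrightarrow> U \<subseteq> S \<and>
     (\<forall>f\<in>U. \<exists>F. finite F \<and> F \<subseteq> \<Omega> \<and> (\<forall>g\<in>S. (\<forall>x\<in>F. g x = f x) \<longrightarrow> g \<in> U))"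
  (is "?L \<longleftrightarrow> ?R")
proof
  assume ?L
  then obtain T where T: "openin (Tr_topology \<Omega>) T" "U = T \<inter> S"
    by (auto simp: openin_subtopology)
  show ?R
  proof (intro conjI ballI)
    show "U \<subseteq> S" using T by blast
    fix f assume "f \<in> U"
    with T obtain F where "finite F" "F \<subseteq> \<Omega>" "{g \<in> carrier (Tr \<Omega>). \<forall>x\<in>F. g x = f x} \<subseteq> T"
      unfolding openin_Tr_topology_iff by blast
    then show "\<exists>F. finite F \<and> F \<subseteq> \<Omega> \<and> (\<forall>g\<in>S. (\<forall>x\<in>F. g x = f x) \<longrightarrow> g \<in> U)"
      using assms T(2) by blast
  qed
next
  assume R: ?R
  (* the largest open set whose trace on S lies in U *)
  let ?T = "{h \<in> carrier (Tr \<Omega>). \<exists>F. finite F \<and> F \<subseteq> \<Omega> \<and>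
    (\<forall>g\<in>S. (\<forall>x\<in>F. g x = h x) \<longrightarrow> g \<in> U)}"
  have "openin (Tr_topology \<Omega>) ?T"
    unfolding openin_Tr_topology_iff
  proof (intro conjI ballI)
    fix h assume "h \<in> ?T"
    then obtain F where F: "finite F" "F \<subseteq> \<Omega>" "\<forall>g\<in>S. (\<forall>x\<in>F. g x = h x) \<longrightarrow> g \<in> U" by blast
    then have "{g \<in> carrier (Tr \<Omega>). \<forall>x\<in>F. g x = h x} \<subseteq> ?T"
      by (auto intro!: exI[of _ F])
    with F show "\<exists>F. finite F \<and> F \<subseteq> \<Omega> \<and> {g \<in> carrier (Tr \<Omega>). \<forall>x\<in>F. g x = h x} \<subseteq> ?T"
      by blast
  qed blast
  moreover have "U = ?T \<inter> S" using R assms by auto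
  ultimately show ?L by (auto simp: openin_subtopology)
qed

lemma closedin_Tr_approx:
  assumes "closedin (Tr_topology \<Omega>) S" and "s \<in> carrier (Tr \<Omega>)"
    and approx: "\<And>F. finite F \<Longrightarrow> F \<subseteq> \<Omega> \<Longrightarrow> \<exists>t\<in>S. \<forall>x\<in>F. t x = s x"
  shows "s \<in> S"
proof (rule ccontr)
  assume "s \<notin> S"
  moreover have "openin (Tr_topology \<Omega>) (carrier (Tr \<Omega>) - S)"
    using assms(1) by (simp add: closedin_def topspace_Tr_topology)
  ultimately obtain F where "finite F" "F \<subseteq> \<Omega>"
      "{g \<in> carrier (Tr \<Omega>). \<forall>x\<in>F. g x = s x} \<subseteq> carrier (Tr \<Omega>) - S"
    using assms(2) unfolding openin_Tr_topology_iff by blast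
  moreover have "S \<subseteq> carrier (Tr \<Omega>)"
    using assms(1) closedin_subset topspace_Tr_topology by blast
  ultimately show False using approx[of F] by blast
qed

section \<open>A Baire category argument\<close>

text \<open>
  A \<open>G\<^sub>\<delta>\<close> set of self-maps of a countable set is completely metrizable. Of the countably
  many colour classes one is therefore dense in some nonempty open set, and that set can
  be taken to be a basic neighbourhood of a member \<open>k\<close> of the class.
\<close>

lemma Baire_countable_colouring:
  fixes G :: "('b::countable \<Rightarrow> 'b) set" and c :: "('b \<Rightarrow> 'b) \<Rightarrow> 'c"
  assumes G: "gdelta_in (Tr_topology UNIV) G" "G \<noteq> {}" and c: "countable (c ` G)"
  obtains k A where "k \<in> G" "finite A"
    "\<And>g B. \<lbrakk>g \<in> G; \<forall>a\<in>A. g a = k a; finite B\<rbrakk> \<Longrightarrow> \<exists>h\<in>G. c h = c k \<and> (\<forall>b\<in>B. h b = g b)"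
proof -
  define X where "X = subtopology (Tr_topology UNIV) G"
  have GC: "G \<subseteq> carrier (Tr UNIV)" by (auto simp: Tr_def)
  have topX: "topspace X = G"
    using GC by (auto simp: X_def topspace_Tr_topology)
  have "completely_metrizable_space (Tr_topology (UNIV :: 'b set))"
    by (simp add: Tr_topology_eq_product_topology completely_metrizable_space_product_topology
        completely_metrizable_space_discrete_topology)
  then have X: "completely_metrizable_space X"
    unfolding X_def using G(1) by (rule completely_metrizable_space_gdelta_in)
  define C where "C y = {h \<in> G. c h = y}" for y
  define D where "D y = X closure_of (C y)" for y
  have D: "closedin X (D y)" "C y \<subseteq> D y" for y
    using closure_of_subset[of "C y" X] by (auto simp: D_def topX C_def)
  have "\<exists>y. X interior_of (D y) \<noteq> {}"
  proof (rule ccontr)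
    assume "\<nexists>y. X interior_of (D y) \<noteq> {}"
    then have "X interior_of \<Union>(D ` c ` G) = {}"
      using X c D(1) by (intro Baire_category_alt) auto
    moreover have "G \<subseteq> \<Union>(D ` c ` G)"
      using D(2) by (auto simp: C_def)
    ultimately have "X interior_of G = {}"
      using interior_of_mono by blast
    then show False using G(2) topX interior_of_topspace by metis
  qed
  then obtain y f where f: "f \<in> X interior_of (D y)" by blast
  define W where "W = X interior_of (D y)"
  have W: "openin X W" "W \<subseteq> D y" "f \<in> W"
    using f interior_of_subset[of X "D y"] by (simp_all add: W_def)
  have "f \<in> X closure_of (C y)" using W(2,3) by (auto simp: D_def)
  then obtain k where k: "k \<in> C y" "k \<in> W"
    using W(1,3) unfolding in_closure_of by blast
  obtain A where A: "finite A" "\<forall>g\<in>G. (\<forall>x\<in>A. g x = k x) \<longrightarrow> g \<in> W"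
    using k(2) W(1) unfolding X_def openin_subtopology_Tr_iff[OF GC] by blast
  show ?thesis
  proof
    show "k \<in> G" "finite A" using k A by (auto simp: C_def)
    fix g and B :: "'b set" assume g: "g \<in> G" "\<forall>a\<in>A. g a = k a" and B: "finite B"
    define V where "V = {h \<in> G. \<forall>b\<in>B. h b = g b}"
    have "g \<in> X closure_of (C y)"
      using A(2) g W(2) by (auto simp: D_def)
    moreover have "openin X V"
      unfolding X_def openin_subtopology_Tr_iff[OF GC]
      using B by (auto simp: V_def intro!: exI[of _ B])
    moreover have "g \<in> V" using g(1) by (simp add: V_def)
    ultimately obtain h where "h \<in> C y" "h \<in> V"
      unfolding in_closure_of by blast
    then show "\<exists>h\<in>G. c h = c k \<and> (\<forall>b\<in>B. h b = g b)"
      using k(1) by (auto simp: C_def V_def)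
  qed
qed

section \<open>Strictly increasing maps of the rationals\<close>

definition Aut_rat :: "(rat \<Rightarrow> rat) set" where
  "Aut_rat = {g. strict_mono g \<and> surj g}"

lemma Aut_ratD: "g \<in> Aut_rat \<Longrightarrow> strict_mono g"
  by (simp add: Aut_rat_def)

lemma id_Aut_rat: "id \<in> Aut_rat"
  by (simp add: Aut_rat_def strict_mono_def)

lemma comp_Aut_rat: "g \<in> Aut_rat \<Longrightarrow> h \<in> Aut_rat \<Longrightarrow> g \<circ> h \<in> Aut_rat"
  using comp_surj strict_mono_o unfolding Aut_rat_def by blast

lemma inv_Aut_rat:
  assumes "g \<in> Aut_rat"
  shows "inv_into UNIV g \<in> Aut_rat" "inv_into UNIV g \<circ> g = id" "g \<circ> inv_into UNIV g = id"
proof -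
  have g: "strict_mono g" "surj g" "inj g"
    using assms by (auto simp: Aut_rat_def strict_mono_imp_inj_on)
  have "strict_mono (inv_into UNIV g)"
  proof (rule strict_monoI)
    fix x y :: rat assume "x < y"
    then have "g (inv_into UNIV g x) < g (inv_into UNIV g y)"
      using g(2) by (simp add: surj_f_inv_f)
    then show "inv_into UNIV g x < inv_into UNIV g y"
      using strict_mono_less[OF g(1)] by simp
  qed
  moreover have "surj (inv_into UNIV g)" using g(3) by (rule inj_imp_surj_inv)
  ultimately show "inv_into UNIV g \<in> Aut_rat" by (simp add: Aut_rat_def)
  show "inv_into UNIV g \<circ> g = id" "g \<circ> inv_into UNIV g = id"
    using g by (auto simp: fun_eq_iff surj_f_inv_f)
qed

text \<open>
  Monotonicity and surjectivity are both countable conjunctions of open conditions: one for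
  each pair \<open>x < y\<close>, and one for each value \<open>y\<close> to be attained.
\<close>

lemma gdelta_in_Aut_rat: "gdelta_in (Tr_topology UNIV) Aut_rat"
proof -
  let ?P = "(\<lambda>(x,y). {f :: rat \<Rightarrow> rat. f x < f y}) ` {(x,y). x < y}"
  let ?Q = "range (\<lambda>y. {f :: rat \<Rightarrow> rat. \<exists>x. y = f x})"
  have "openin (Tr_topology UNIV) {f :: rat \<Rightarrow> rat. f x < f y}" for x y
    unfolding openin_Tr_topology_iff by (force simp: Tr_def intro!: exI[of _ "{x,y}"])
  moreover have "openin (Tr_topology UNIV) {f :: rat \<Rightarrow> rat. \<exists>x. y = f x}" for y
    unfolding openin_Tr_topology_iff
  proof (intro conjI ballI)
    fix f :: "rat \<Rightarrow> rat" assume "f \<in> {f. \<exists>x. y = f x}"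
    then obtain x where "y = f x" by blast
    then show "\<exists>F. finite F \<and> F \<subseteq> UNIV \<and>
        {g \<in> carrier (Tr UNIV). \<forall>x\<in>F. g x = f x} \<subseteq> {f. \<exists>x. y = f x}"
      by (intro exI[of _ "{x}"]) (auto intro: sym)
  qed (auto simp: Tr_def)
  ultimately have "gdelta_in (Tr_topology UNIV) (\<Inter>(?P \<union> ?Q))"
    by (intro gdelta_in_Inter open_imp_gdelta_in) (auto intro: countableI_type)
  moreover have "\<Inter>(?P \<union> ?Q) = Aut_rat"
    unfolding Aut_rat_def strict_mono_def surj_def Inter_Un_distrib by auto
  ultimately show ?thesis by simp
qed

text \<open>
  This is the density of the automorphisms among the embeddings. The interpolating bijection
  is built from left to right: beyond the largest point already treated, it is replaced by the line
  through the last two prescribed points.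
\<close>

lemma Aut_rat_interpolation:
  assumes "finite A" and f: "strict_mono f"
  obtains g where "g \<in> Aut_rat" "\<And>a. a \<in> A \<Longrightarrow> g a = f a"
proof -
  from \<open>finite A\<close> have "\<exists>g\<in>Aut_rat. \<forall>a\<in>A. g a = f a"
  proof (induction A rule: finite_linorder_max_induct)
    case empty
    then show ?case using id_Aut_rat by blast
  next
    case (insert b A)
    then obtain g where g: "g \<in> Aut_rat" "\<forall>a\<in>A. g a = f a" by blast
    show ?case
    proof (cases "A = {}")
      case True
      have "x \<in> range (\<lambda>x. x + (f b - b))" for x by (rule range_eqI[of _ _ "x - (f b - b)"]) simp
      then have "(\<lambda>x. x + (f b - b)) \<in> Aut_rat"
        by (auto simp: Aut_rat_def strict_mono_def)
      then show ?thesis using True by (intro bexI[of _ "\<lambda>x. x + (f b - b)"]) auto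
    next
      case False
      define m where "m = Max A"
      have m: "m \<in> A" "\<And>a. a \<in> A \<Longrightarrow> a \<le> m" "m < b"
        using insert False by (auto simp: m_def)
      define r where "r = (f b - f m) / (b - m)"
      have gm: "g m = f m" using g m by blast
      have r: "r > 0" using f m(3) by (simp add: r_def strict_mono_def)
      define h where "h x = (if x \<le> m then g x else f m + r * (x - m))" for x
      have gmono: "\<And>x y. x < y \<Longrightarrow> g x < g y" using g by (auto simp: Aut_rat_def strict_mono_def)
      have "h x < h y" if "x < y" for x y
      proof -
        consider "y \<le> m" | "x \<le> m" "m < y" | "m < x" by linarith
        then show ?thesis
        proof cases
          case 1
          then show ?thesis using gmono that by (simp add: h_def)
        next
          case 2
          then have "g x \<le> f m" using gmono[of x m] gm by (cases "x = m") auto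
          moreover have "0 < r * (y - m)" using 2 r by simp
          ultimately show ?thesis using 2 by (simp add: h_def)
        next
          case 3
          then show ?thesis using that r by (simp add: h_def)
        qed
      qed
      moreover have "z \<in> range h" for z
      proof (cases "z \<le> f m")
        case True
        have "surj g" using g(1) by (simp add: Aut_rat_def)
        then obtain x where x: "z = g x" by (rule surjE)
        have "\<not> m < x" using True x gm gmono[of m x] by auto
        then have "z = h x" using x by (simp add: h_def)
        then show ?thesis by (rule range_eqI)
      next
        case False
        then have "(z - f m) / r > 0" using r by simp
        then have "z = h (m + (z - f m) / r)" using r by (simp add: h_def)
        then show ?thesis by (rule range_eqI)
      qed
      ultimately have "h \<in> Aut_rat" by (auto simp: Aut_rat_def strict_mono_def)
      moreover have "h a = f a" if "a \<in> insert b A" for a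
        using that m g by (auto simp: h_def r_def)
      ultimately show ?thesis by blast
    qed
  qed
  then show ?thesis using that by blast
qed

text \<open>
  If every point above \<open>y\<close> is moved up by 2, then strict monotonicity leaves the value at \<open>y\<close> free
  between \<open>y\<close> and \<open>y + 2\<close>, so two maps can be separated there and nowhere else.
\<close>

lemma strict_mono_pair_separating_point:
  fixes y :: rat
  obtains p q :: "rat \<Rightarrow> rat" where "strict_mono p" "strict_mono q"
    "\<And>z. p z \<noteq> q z \<longleftrightarrow> z = y"
proof
  show "strict_mono (\<lambda>z. if z \<le> y then z else z + 2)"
    "strict_mono (\<lambda>z. if z < y then z else if z = y then y + 1 else z + 2)"
    by (auto simp: strict_mono_def)
qed auto

text \<open>
  An embedded copy of the rationals has no isolated point in its own order, but it may be isolated at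
  \<open>x\<close> as a subset of the rationals: \<open>u\<close> moves everything except \<open>x\<close> to a distance greater than 1
  from \<open>x\<close>, while \<open>v\<close> squeezes the line into the interval of radius 1 around \<open>x\<close>.
\<close>

lemma strict_mono_pair_meeting_in_point:
  fixes x :: rat
  obtains u v :: "rat \<Rightarrow> rat" where "strict_mono u" "strict_mono v" "u x = x" "v x = x"
    "\<And>s t. u s = v t \<Longrightarrow> u s = x"
proof
  let ?u = "\<lambda>t. if t < x then t - 1 else if t = x then x else t + 1"
  let ?v = "\<lambda>t. x + (t - x) / (1 + \<bar>t - x\<bar>)"
  show "strict_mono ?u" by (auto simp: strict_mono_def)
  have *: "a / (1 + \<bar>a\<bar>) < b / (1 + \<bar>b\<bar>)" if "a < b" for a b :: rat
  proof -
    have "a * (1 + \<bar>b\<bar>) < b * (1 + \<bar>a\<bar>)"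
    proof (cases "a \<ge> 0 \<or> b \<le> 0")
      case True
      then have "a * \<bar>b\<bar> = b * \<bar>a\<bar>" using that by (auto simp: abs_if)
      then show ?thesis using that by (simp add: algebra_simps)
    next
      case False
      then have "a * (1 + \<bar>b\<bar>) < 0" "0 < b * (1 + \<bar>a\<bar>)"
        by (auto intro!: mult_neg_pos mult_pos_pos)
      then show ?thesis by linarith
    qed
    moreover have "0 < 1 + \<bar>a\<bar>" "0 < 1 + \<bar>b\<bar>" by linarith+
    ultimately show ?thesis by (simp add: pos_less_divide_eq pos_divide_less_eq)
  qed
  show "strict_mono ?v" by (auto simp: strict_mono_def intro!: *)
  show "?u s = x" if "?u s = ?v t" for s t
  proof -
    have "\<bar>a / (1 + \<bar>a\<bar>)\<bar> < 1" for a :: rat by (simp add: divide_simps abs_if)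
    from this[of "t - x"] have "\<bar>?v t - x\<bar> < 1" by simp
    then have "\<bar>?u s - x\<bar> < 1" using that by simp
    then show ?thesis by (auto split: if_splits)
  qed
qed auto

section \<open>Closed faithful actions of the embedding monoid\<close>

text \<open>
  The assumption \<open>closed\<close> is topological closedness of the image of \<open>\<theta>\<close> in finitary form.
  The lemmas of this locale likewise express continuity and density by finite sets of points.
\<close>

locale closed_faithful_action =
  fixes \<Omega> :: "'a set" and \<theta> :: "(rat \<Rightarrow> rat) \<Rightarrow> 'a \<Rightarrow> 'a"
  assumes countable: "countable \<Omega>"
    and maps: "strict_mono f \<Longrightarrow> \<theta> f \<in> \<Omega> \<rightarrow>\<^sub>E \<Omega>"
    and comp: "strict_mono f \<Longrightarrow> strict_mono g \<Longrightarrow> \<omega> \<in> \<Omega> \<Longrightarrow> \<theta> (f \<circ> g) \<omega> = \<theta> f (\<theta> g \<omega>)"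
    and id: "\<omega> \<in> \<Omega> \<Longrightarrow> \<theta> id \<omega> = \<omega>"
    and faithful: "strict_mono f \<Longrightarrow> strict_mono g \<Longrightarrow> \<theta> f = \<theta> g \<Longrightarrow> f = g"
    and closed: "s \<in> \<Omega> \<rightarrow>\<^sub>E \<Omega> \<Longrightarrow>
      (\<And>F. finite F \<Longrightarrow> F \<subseteq> \<Omega> \<Longrightarrow> \<exists>f. strict_mono f \<and> (\<forall>\<omega>\<in>F. \<theta> f \<omega> = s \<omega>)) \<Longrightarrow>
      \<exists>f. strict_mono f \<and> s = \<theta> f"
begin

lemma in_\<Omega>: "strict_mono f \<Longrightarrow> \<omega> \<in> \<Omega> \<Longrightarrow> \<theta> f \<omega> \<in> \<Omega>"
  using maps by (auto simp: PiE_iff)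

lemma differ_somewhere:
  assumes "strict_mono f" "strict_mono g" "f \<noteq> g"
  obtains \<omega> where "\<omega> \<in> \<Omega>" "\<theta> f \<omega> \<noteq> \<theta> g \<omega>"
proof -
  have "\<theta> f \<noteq> \<theta> g" using assms faithful by blast
  moreover have "\<theta> f = \<theta> g" if "\<And>\<omega>. \<omega> \<in> \<Omega> \<Longrightarrow> \<theta> f \<omega> = \<theta> g \<omega>"
    using PiE_ext[OF maps[OF assms(1)] maps[OF assms(2)] that] .
  ultimately show ?thesis using that by blast
qed

text \<open>
  The condition that the value \<open>f (u x)\<close> be attained by \<open>h \<circ> u\<close> is the inequation
  \<open>p \<circ> h \<circ> u \<noteq> q \<circ> h \<circ> u\<close> for a pair \<open>p\<close>, \<open>q\<close> that differs exactly at that value. The inequation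
  holds for \<open>f\<close>, and its image under \<open>\<theta>\<close> is witnessed at some point; whether it is witnessed there
  depends only on the value of \<open>\<theta> h\<close> at the image of that point under \<open>\<theta> u\<close>.
\<close>

lemma range_condition_open:
  fixes f u :: "rat \<Rightarrow> rat"
  assumes f: "strict_mono f" and u: "strict_mono u"
  obtains \<omega> where "\<omega> \<in> \<Omega>"
    "\<And>h. \<lbrakk>strict_mono h; \<theta> h \<omega> = \<theta> f \<omega>\<rbrakk> \<Longrightarrow> \<exists>t. h (u t) = f (u x)"
proof -
  obtain p q :: "rat \<Rightarrow> rat" where pq: "strict_mono p" "strict_mono q" "\<And>z. p z \<noteq> q z \<longleftrightarrow> z = f (u x)"
    using strict_mono_pair_separating_point by metis
  have c: "strict_mono (a \<circ> b)" if "strict_mono a" "strict_mono b" for a b :: "rat \<Rightarrow> rat"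
    using that by (rule strict_mono_o)
  have "(p \<circ> (f \<circ> u)) x \<noteq> (q \<circ> (f \<circ> u)) x" using pq(3) by simp
  then have "p \<circ> (f \<circ> u) \<noteq> q \<circ> (f \<circ> u)" by metis
  then obtain \<omega> where \<omega>: "\<omega> \<in> \<Omega>" "\<theta> (p \<circ> (f \<circ> u)) \<omega> \<noteq> \<theta> (q \<circ> (f \<circ> u)) \<omega>"
    using differ_somewhere c f u pq by metis
  have "\<exists>t. h (u t) = f (u x)" if h: "strict_mono h" "\<theta> h (\<theta> u \<omega>) = \<theta> f (\<theta> u \<omega>)" for h
  proof -
    have "\<theta> (p \<circ> (h \<circ> u)) \<omega> \<noteq> \<theta> (q \<circ> (h \<circ> u)) \<omega>"
      using \<omega> h f u pq by (simp add: comp c in_\<Omega>)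
    then have "p \<circ> (h \<circ> u) \<noteq> q \<circ> (h \<circ> u)" by metis
    then show ?thesis using pq(3) by (auto simp: fun_eq_iff)
  qed
  then show ?thesis using that[of "\<theta> u \<omega>"] in_\<Omega> u \<omega> by blast
qed

text \<open>
  By the preceding lemma for \<open>u\<close> and for \<open>v\<close>, two points of \<open>\<Omega>\<close> suffice to force \<open>f x\<close> to be a
  value of \<open>h\<close> on both ranges. As \<open>h\<close> is injective and the ranges share only \<open>x\<close>, it is attained at \<open>x\<close>.
\<close>

lemma inverse_continuous_at_point:
  assumes f: "strict_mono f"
  obtains F where "finite F" "F \<subseteq> \<Omega>"
    "\<And>h. \<lbrakk>strict_mono h; \<forall>\<omega>\<in>F. \<theta> h \<omega> = \<theta> f \<omega>\<rbrakk> \<Longrightarrow> h x = f x"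
proof -
  obtain u v :: "rat \<Rightarrow> rat" where uv: "strict_mono u" "strict_mono v" "u x = x" "v x = x"
      "\<And>s t. u s = v t \<Longrightarrow> u s = x"
    using strict_mono_pair_meeting_in_point by metis
  obtain \<omega>1 where 1: "\<omega>1 \<in> \<Omega>"
      "\<And>h. \<lbrakk>strict_mono h; \<theta> h \<omega>1 = \<theta> f \<omega>1\<rbrakk> \<Longrightarrow> \<exists>t. h (u t) = f (u x)"
    using range_condition_open[OF f uv(1)] by metis
  obtain \<omega>2 where 2: "\<omega>2 \<in> \<Omega>"
      "\<And>h. \<lbrakk>strict_mono h; \<theta> h \<omega>2 = \<theta> f \<omega>2\<rbrakk> \<Longrightarrow> \<exists>t. h (v t) = f (v x)"
    using range_condition_open[OF f uv(2)] by metis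
  have "h x = f x" if h: "strict_mono h" "\<forall>\<omega>\<in>{\<omega>1, \<omega>2}. \<theta> h \<omega> = \<theta> f \<omega>" for h
  proof -
    have "\<exists>s. h (u s) = f x" "\<exists>t. h (v t) = f x"
      using 1(2)[OF h(1)] 2(2)[OF h(1)] h(2) uv(3,4) by simp_all
    then obtain s t where "h (u s) = f x" "h (v t) = f x" by blast
    then show ?thesis by (metis h(1) strict_mono_eq uv(5))
  qed
  then show ?thesis using that[of "{\<omega>1, \<omega>2}"] 1 2 by blast
qed

lemma inverse_continuous:
  assumes f: "strict_mono f" and "finite A"
  obtains F where "finite F" "F \<subseteq> \<Omega>"
    "\<And>h. \<lbrakk>strict_mono h; \<forall>\<omega>\<in>F. \<theta> h \<omega> = \<theta> f \<omega>\<rbrakk> \<Longrightarrow> \<forall>x\<in>A. h x = f x"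
proof -
  have "\<exists>F. finite F \<and> F \<subseteq> \<Omega> \<and>
      (\<forall>h. strict_mono h \<longrightarrow> (\<forall>\<omega>\<in>F. \<theta> h \<omega> = \<theta> f \<omega>) \<longrightarrow> h x = f x)" for x
    using inverse_continuous_at_point[OF f, of x] by metis
  then obtain F where F: "\<And>x. finite (F x)" "\<And>x. F x \<subseteq> \<Omega>"
      "\<And>x h. \<lbrakk>strict_mono h; \<forall>\<omega>\<in>F x. \<theta> h \<omega> = \<theta> f \<omega>\<rbrakk> \<Longrightarrow> h x = f x"
    by metis
  show ?thesis
  proof (rule that[of "\<Union>x\<in>A. F x"])
    show "finite (\<Union>x\<in>A. F x)" "(\<Union>x\<in>A. F x) \<subseteq> \<Omega>" using F(1,2) \<open>finite A\<close> by auto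
    show "\<forall>x\<in>A. h x = f x" if "strict_mono h" "\<forall>\<omega>\<in>(\<Union>x\<in>A. F x). \<theta> h \<omega> = \<theta> f \<omega>" for h
      using F(3)[OF that(1)] that(2) by simp
  qed
qed

text \<open>
  Closedness makes \<open>s\<close> the image of some \<open>f\<close>, and continuity of the inverse of \<open>\<theta>\<close> at \<open>s\<close> forces the
  approximants to agree with \<open>f\<close>, as well as with \<open>g\<close>, at any given rational.
\<close>

lemma closed_graph:
  assumes g: "strict_mono g" and s: "s \<in> \<Omega> \<rightarrow>\<^sub>E \<Omega>"
    and approx: "\<And>F x. \<lbrakk>finite F; F \<subseteq> \<Omega>\<rbrakk> \<Longrightarrow>
      \<exists>v. strict_mono v \<and> v x = g x \<and> (\<forall>\<omega>\<in>F. \<theta> v \<omega> = s \<omega>)"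
  shows "s = \<theta> g"
proof -
  obtain f where f: "strict_mono f" "s = \<theta> f"
    using closed[OF s] approx by metis
  have "g x = f x" for x
  proof -
    obtain F where F: "finite F" "F \<subseteq> \<Omega>"
        "\<And>h. \<lbrakk>strict_mono h; \<forall>\<omega>\<in>F. \<theta> h \<omega> = \<theta> f \<omega>\<rbrakk> \<Longrightarrow> h x = f x"
      using inverse_continuous_at_point[OF f(1)] by metis
    then show ?thesis using approx[OF F(1,2), of x] f(2) by metis
  qed
  then have "g = f" by blast
  then show ?thesis using f by blast
qed

text \<open>
  Colour an automorphism \<open>g\<close> by the restriction of \<open>\<theta> g\<close> to \<open>F\<close>. The colour classes are the cosets of
  the stabiliser of \<open>F\<close>, and one of them is dense near some \<open>k\<close>; translating by the inverse of \<open>k\<close> moves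
  this to the identity.
\<close>

lemma stabiliser_dense_in_pointwise_stabiliser:
  assumes F: "finite F" "F \<subseteq> \<Omega>"
  obtains A where "finite A"
    "\<And>g B. \<lbrakk>g \<in> Aut_rat; \<forall>a\<in>A. g a = a; finite B\<rbrakk> \<Longrightarrow>
      \<exists>h\<in>Aut_rat. (\<forall>\<omega>\<in>F. \<theta> h \<omega> = \<omega>) \<and> (\<forall>b\<in>B. h b = g b)"
proof -
  define c where "c g = restrict (\<theta> g) F" for g
  have "c ` Aut_rat \<subseteq> F \<rightarrow>\<^sub>E \<Omega>"
    using F in_\<Omega> by (auto simp: c_def Aut_rat_def)
  moreover have "countable (F \<rightarrow>\<^sub>E \<Omega>)" using F(1) countable by (intro countable_PiE) auto
  ultimately have cnt: "countable (c ` Aut_rat)" by (rule countable_subset)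
  have "Aut_rat \<noteq> {}" using id_Aut_rat by blast
  obtain k A where k: "k \<in> Aut_rat" and A: "finite A"
    "\<And>g B. \<lbrakk>g \<in> Aut_rat; \<forall>a\<in>A. g a = k a; finite B\<rbrakk> \<Longrightarrow>
      \<exists>h\<in>Aut_rat. c h = c k \<and> (\<forall>b\<in>B. h b = g b)"
    using Baire_countable_colouring[OF gdelta_in_Aut_rat \<open>Aut_rat \<noteq> {}\<close> cnt] by blast
  note k' = inv_Aut_rat[OF k]
  have "\<exists>h\<in>Aut_rat. (\<forall>\<omega>\<in>F. \<theta> h \<omega> = \<omega>) \<and> (\<forall>b\<in>B. h b = g b)"
    if g: "g \<in> Aut_rat" "\<forall>a\<in>A. g a = a" and B: "finite B" for g B
  proof -
    have "\<exists>h\<in>Aut_rat. c h = c k \<and> (\<forall>b\<in>B. h b = (k \<circ> g) b)"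
      using g k B by (intro A(2) comp_Aut_rat) auto
    then obtain h where h: "h \<in> Aut_rat" "c h = c k" "\<forall>b\<in>B. h b = (k \<circ> g) b" by blast
    have "\<theta> (inv_into UNIV k \<circ> h) \<omega> = \<omega>" if \<omega>: "\<omega> \<in> F" for \<omega>
    proof -
      have "\<omega> \<in> \<Omega>" using \<omega> F by blast
      have "\<theta> h \<omega> = \<theta> k \<omega>" using h(2) \<omega> unfolding c_def by (metis restrict_apply')
      then have "\<theta> (inv_into UNIV k \<circ> h) \<omega> = \<theta> (inv_into UNIV k \<circ> k) \<omega>"
        using comp[OF Aut_ratD[OF k'(1)] _ \<open>\<omega> \<in> \<Omega>\<close>] h(1) k by (simp add: Aut_ratD)
      then show ?thesis using k'(2) id \<open>\<omega> \<in> \<Omega>\<close> by simp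
    qed
    moreover have "(inv_into UNIV k \<circ> h) b = g b" if "b \<in> B" for b
      using h(3) that k'(2) by (simp add: fun_eq_iff)
    ultimately show ?thesis using comp_Aut_rat[OF k'(1) h(1)] by blast
  qed
  then show ?thesis using that A(1) by blast
qed

text \<open>
  This is the successive approximation of the open mapping theorem. Given \<open>g\<close>, one builds
  automorphisms \<open>v n\<close> that agree with \<open>g\<close> on finite sets exhausting the rationals. Passing from
  \<open>v n\<close> to the next one multiplies on the right by an automorphism acting trivially on \<open>\<omega>\<close> and on the
  first \<open>n\<close> points of \<open>\<Omega>\<close>. The density lemma supplies this factor, as an approximation to \<open>g\<close> followed by the
  inverse of \<open>v n\<close>, which fixes the finite set of rationals on which \<open>v n\<close> and \<open>g\<close> agree.
  So the maps \<open>\<theta> (v n)\<close> are eventually constant at each point and constant at \<open>\<omega>\<close>, and the closed graph identifies their limit as \<open>\<theta> g\<close>.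
\<close>

lemma pointwise_stabiliser_fixes:
  assumes \<omega>: "\<omega> \<in> \<Omega>"
  obtains A where "finite A" "\<And>g. \<lbrakk>g \<in> Aut_rat; \<forall>a\<in>A. g a = a\<rbrakk> \<Longrightarrow> \<theta> g \<omega> = \<omega>"
proof -
  (* the point \<omega> belongs to every F n, so that it is fixed at every step *)
  define F where "F n = insert \<omega> (from_nat_into \<Omega> ` {..<n})" for n
  have F: "finite (F n)" "F n \<subseteq> \<Omega>" for n
    using \<omega> from_nat_into[of \<Omega>] by (auto simp: F_def)
  have F_mono: "F m \<subseteq> F n" if "m \<le> n" for m n using that by (auto simp: F_def)
  have F_exhaust: "\<exists>n. H \<subseteq> F n" if "finite H" "H \<subseteq> \<Omega>" for H
    using that
  proof (induction H rule: finite_induct)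
    case (insert x H)
    then obtain n where n: "H \<subseteq> F n" by blast
    have "x \<in> \<Omega>" using insert.prems by blast
    then obtain i where i: "from_nat_into \<Omega> i = x"
      using from_nat_into_surj[OF countable] by blast
    have "x \<in> F (Suc i)" by (auto simp: F_def i[symmetric])
    then have "insert x H \<subseteq> F (max n (Suc i))"
      using n F_mono[of n "max n (Suc i)"] F_mono[of "Suc i" "max n (Suc i)"] by auto
    then show ?case by blast
  qed simp
  have "\<exists>A. finite A \<and> (\<forall>g B. g \<in> Aut_rat \<longrightarrow> (\<forall>a\<in>A. g a = a) \<longrightarrow> finite B \<longrightarrow>
      (\<exists>h\<in>Aut_rat. (\<forall>\<omega>\<in>F n. \<theta> h \<omega> = \<omega>) \<and> (\<forall>b\<in>B. h b = g b)))" for n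
    using stabiliser_dense_in_pointwise_stabiliser[OF F] by metis
  then obtain A where A: "\<And>n. finite (A n)"
      "\<And>n g B. \<lbrakk>g \<in> Aut_rat; \<forall>a\<in>A n. g a = a; finite B\<rbrakk> \<Longrightarrow>
        \<exists>h\<in>Aut_rat. (\<forall>\<omega>\<in>F n. \<theta> h \<omega> = \<omega>) \<and> (\<forall>b\<in>B. h b = g b)"
    by metis
  define B where "B n = A n \<union> from_nat ` {..<n}" for n :: nat
  have B: "finite (B n)" for n by (simp add: B_def A(1))
  have "\<theta> g \<omega> = \<omega>" if g: "g \<in> Aut_rat" "\<forall>a\<in>A 0. g a = a" for g
  proof -
    define P where "P n w \<longleftrightarrow> w \<in> Aut_rat \<and> (\<forall>b\<in>B n. w b = g b)" for n w
    define Q where "Q n w w' \<longleftrightarrow> (\<forall>\<eta>\<in>F n. \<theta> w' \<eta> = \<theta> w \<eta>)" for n w w'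
    have "P 0 id" using g id_Aut_rat by (simp add: P_def B_def)
    have step: "\<exists>w'. P (Suc n) w' \<and> Q n w w'" if "P n w" for n w
    proof -
      have w: "w \<in> Aut_rat" "\<forall>b\<in>B n. w b = g b" using that by (auto simp: P_def)
      note w' = inv_Aut_rat[OF w(1)]
      have "(inv_into UNIV w \<circ> g) a = a" if "a \<in> A n" for a
      proof -
        have "g a = w a" using w(2) that by (simp add: B_def)
        then show ?thesis using w'(2) by (simp add: fun_eq_iff)
      qed
      then obtain h where h: "h \<in> Aut_rat" "\<forall>\<eta>\<in>F n. \<theta> h \<eta> = \<eta>"
          "\<forall>b\<in>B (Suc n). h b = (inv_into UNIV w \<circ> g) b"
        using A(2)[OF comp_Aut_rat[OF w'(1) g(1)] _ B] by metis
      have "P (Suc n) (w \<circ> h)"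
        using h w w'(3) by (simp add: P_def comp_Aut_rat fun_eq_iff)
      moreover have "Q n w (w \<circ> h)"
        unfolding Q_def
      proof
        fix \<eta> assume "\<eta> \<in> F n"
        moreover from this have "\<eta> \<in> \<Omega>" using F(2) by blast
        ultimately show "\<theta> (w \<circ> h) \<eta> = \<theta> w \<eta>"
          using comp[of w h \<eta>] h w by (simp add: Aut_ratD)
      qed
      ultimately show ?thesis by blast
    qed
    have "\<exists>v. v 0 = id \<and> (\<forall>n. P n (v n) \<and> Q n (v n) (v (Suc n)))"
    proof -
      have "\<exists>v. \<forall>n. (P n (v n) \<and> (n = 0 \<longrightarrow> v n = id)) \<and> Q n (v n) (v (Suc n))"
      proof (rule dependent_nat_choice)
        show "\<exists>w. P 0 w \<and> (0 = (0::nat) \<longrightarrow> w = id)" using \<open>P 0 id\<close> by blast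
        show "\<exists>w'. (P (Suc n) w' \<and> (Suc n = 0 \<longrightarrow> w' = id)) \<and> Q n w w'"
          if "P n w \<and> (n = 0 \<longrightarrow> w = id)" for w n
          using step that by blast
      qed
      then show ?thesis by blast
    qed
    then obtain v where v0: "v 0 = id" and vP: "\<And>n. P n (v n)"
      and vQ: "\<And>n. Q n (v n) (v (Suc n))" by blast
    have vA: "strict_mono (v n)" for n using vP by (auto simp: P_def Aut_ratD)
    have stable: "\<theta> (v n) \<eta> = \<theta> (v m) \<eta>" if "\<eta> \<in> F m" "m \<le> n" for \<eta> m n
      using that(2)
    proof (induction n rule: dec_induct)
      case (step n)
      then have "\<eta> \<in> F n" using that(1) F_mono by blast
      then show ?case using vQ[of n] step by (simp add: Q_def)
    qed simp
    define N where "N \<eta> = (LEAST n. \<eta> \<in> F n)" for \<eta>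
    have N: "\<eta> \<in> F (N \<eta>)" if "\<eta> \<in> \<Omega>" for \<eta>
    proof -
      have "\<exists>n. \<eta> \<in> F n" using F_exhaust[of "{\<eta>}"] that by auto
      then show ?thesis unfolding N_def by (rule LeastI_ex)
    qed
    define s where "s = (\<lambda>\<eta>\<in>\<Omega>. \<theta> (v (N \<eta>)) \<eta>)"
    have s: "\<theta> (v n) \<eta> = s \<eta>" if "\<eta> \<in> F n" for \<eta> n
    proof -
      have "\<eta> \<in> \<Omega>" using that F(2) by blast
      moreover have "N \<eta> \<le> n" unfolding N_def using that by (rule Least_le)
      ultimately show ?thesis using stable[of \<eta> "N \<eta>" n] N[of \<eta>] by (simp add: s_def)
    qed
    have "s = \<theta> g"
    proof (rule closed_graph)
      show "strict_mono g" using g by (rule_tac Aut_ratD)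
      show "s \<in> \<Omega> \<rightarrow>\<^sub>E \<Omega>" using in_\<Omega> vA by (auto simp: s_def)
      fix H and x :: rat assume H: "finite H" "H \<subseteq> \<Omega>"
      obtain m where m: "H \<subseteq> F m" using F_exhaust[OF H] by blast
      define n where "n = max m (Suc (to_nat x))"
      have "H \<subseteq> F n" using m F_mono[of m n] by (auto simp: n_def)
      moreover have "x \<in> B n"
      proof -
        have "to_nat x \<in> {..<n}" by (simp add: n_def)
        then have "from_nat (to_nat x) \<in> B n" unfolding B_def by blast
        then show ?thesis by simp
      qed
      ultimately show "\<exists>w. strict_mono w \<and> w x = g x \<and> (\<forall>\<omega>\<in>H. \<theta> w \<omega> = s \<omega>)"
        using vP[of n] vA s by (intro exI[of _ "v n"]) (auto simp: P_def)
    qed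
    moreover have "\<omega> \<in> F 0" by (simp add: F_def)
    then have "s \<omega> = \<omega>" using s[of \<omega> 0] v0 id \<omega> by simp
    ultimately show ?thesis by simp
  qed
  then show ?thesis using that A(1) by blast
qed

lemma Aut_continuous:
  assumes \<omega>: "\<omega> \<in> \<Omega>"
  obtains A where "finite A"
    "\<And>g h. \<lbrakk>g \<in> Aut_rat; h \<in> Aut_rat; \<forall>a\<in>A. g a = h a\<rbrakk> \<Longrightarrow> \<theta> g \<omega> = \<theta> h \<omega>"
proof -
  obtain A where A: "finite A" "\<And>g. \<lbrakk>g \<in> Aut_rat; \<forall>a\<in>A. g a = a\<rbrakk> \<Longrightarrow> \<theta> g \<omega> = \<omega>"
    using pointwise_stabiliser_fixes[OF \<omega>] by metis
  have "\<theta> g \<omega> = \<theta> h \<omega>" if gh: "g \<in> Aut_rat" "h \<in> Aut_rat" "\<forall>a\<in>A. g a = h a" for g h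
  proof -
    note h' = inv_Aut_rat[OF gh(2)]
    have "(inv_into UNIV h \<circ> g) a = a" if "a \<in> A" for a
      using gh(3) that h'(2) by (simp add: fun_eq_iff)
    then have fixed: "\<theta> (inv_into UNIV h \<circ> g) \<omega> = \<omega>" using A(2) comp_Aut_rat[OF h'(1) gh(1)] by blast
    have "\<theta> g \<omega> = \<theta> (h \<circ> (inv_into UNIV h \<circ> g)) \<omega>" using h'(3) by (simp flip: comp_assoc)
    also have "\<dots> = \<theta> h \<omega>"
      using comp[of h "inv_into UNIV h \<circ> g" \<omega>] fixed gh \<omega> comp_Aut_rat[OF h'(1) gh(1)] by (simp add: Aut_ratD)
    finally show ?thesis .
  qed
  then show ?thesis using that A(1) by blast
qed

text \<open>
  The key claim is that \<open>\<theta> f \<eta> = \<theta> g \<eta>\<close> whenever the automorphism \<open>g\<close> agrees with the embedding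
  \<open>f\<close> on the finite set that controls \<open>\<eta>\<close> within the automorphism group. Choosing such an automorphism
  separately for each point of \<open>\<Omega>\<close> defines a map \<open>s\<close>, the limit of \<open>\<theta> w\<close> for automorphisms \<open>w\<close>
  tending to \<open>f\<close>, and the closed graph gives \<open>s = \<theta> f\<close>. Two embeddings that agree on the
  controlling set of \<open>\<omega>\<close> are then compared through a common interpolating automorphism.
\<close>

lemma continuous_at_point:
  assumes \<omega>: "\<omega> \<in> \<Omega>"
  obtains A where "finite A"
    "\<And>f h. \<lbrakk>strict_mono f; strict_mono h; \<forall>a\<in>A. f a = h a\<rbrakk> \<Longrightarrow> \<theta> f \<omega> = \<theta> h \<omega>"
proof -
  have "\<exists>A. finite A \<and> (\<forall>g h. g \<in> Aut_rat \<longrightarrow> h \<in> Aut_rat \<longrightarrow> (\<forall>a\<in>A. g a = h a) \<longrightarrow>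
      \<theta> g \<eta> = \<theta> h \<eta>)" if "\<eta> \<in> \<Omega>" for \<eta>
    using Aut_continuous[OF that] by metis
  then obtain A where A: "\<And>\<eta>. \<eta> \<in> \<Omega> \<Longrightarrow> finite (A \<eta>)"
    "\<And>\<eta> g h. \<lbrakk>\<eta> \<in> \<Omega>; g \<in> Aut_rat; h \<in> Aut_rat; \<forall>a\<in>A \<eta>. g a = h a\<rbrakk> \<Longrightarrow> \<theta> g \<eta> = \<theta> h \<eta>"
    by metis
  have Aut: "\<theta> f \<eta> = \<theta> g \<eta>"
    if f: "strict_mono f" and g: "g \<in> Aut_rat" "\<forall>a\<in>A \<eta>. g a = f a" and \<eta>: "\<eta> \<in> \<Omega>" for f g \<eta>
  proof -
    have "\<exists>k\<in>Aut_rat. \<forall>a\<in>A \<zeta>. k a = f a" if "\<zeta> \<in> \<Omega>" for \<zeta>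
      using Aut_rat_interpolation[OF A(1)[OF that] f] by metis
    then obtain k where k: "\<And>\<zeta>. \<zeta> \<in> \<Omega> \<Longrightarrow> k \<zeta> \<in> Aut_rat"
        "\<And>\<zeta>. \<zeta> \<in> \<Omega> \<Longrightarrow> \<forall>a\<in>A \<zeta>. k \<zeta> a = f a"
      by metis
    define s where "s = (\<lambda>\<zeta>\<in>\<Omega>. \<theta> (k \<zeta>) \<zeta>)"
    have "s = \<theta> f"
    proof (rule closed_graph[OF f])
      show "s \<in> \<Omega> \<rightarrow>\<^sub>E \<Omega>" using in_\<Omega> k(1) by (auto simp: s_def Aut_ratD)
      fix F and x :: rat assume F: "finite F" "F \<subseteq> \<Omega>"
      have "finite (insert x (\<Union>\<zeta>\<in>F. A \<zeta>))" using F A(1) by auto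
      then obtain w where w: "w \<in> Aut_rat" "\<And>a. a \<in> insert x (\<Union>\<zeta>\<in>F. A \<zeta>) \<Longrightarrow> w a = f a"
        using Aut_rat_interpolation f by metis
      have "\<theta> w \<zeta> = s \<zeta>" if "\<zeta> \<in> F" for \<zeta>
      proof -
        have "\<zeta> \<in> \<Omega>" using that F by blast
        then have "\<theta> w \<zeta> = \<theta> (k \<zeta>) \<zeta>" using A(2) k w that by (metis UN_I insertCI)
        then show ?thesis using \<open>\<zeta> \<in> \<Omega>\<close> by (simp add: s_def)
      qed
      then show "\<exists>w. strict_mono w \<and> w x = f x \<and> (\<forall>\<zeta>\<in>F. \<theta> w \<zeta> = s \<zeta>)"
        using w Aut_ratD by blast
    qed
    then have "\<theta> f \<eta> = \<theta> (k \<eta>) \<eta>" using \<eta> by (simp add: s_def flip: \<open>s = \<theta> f\<close>)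
    also have "\<dots> = \<theta> g \<eta>" using A(2) k g \<eta> by metis
    finally show ?thesis .
  qed
  have "\<theta> f \<omega> = \<theta> h \<omega>" if fh: "strict_mono f" "strict_mono h" "\<forall>a\<in>A \<omega>. f a = h a" for f h
  proof -
    obtain g where "g \<in> Aut_rat" "\<And>a. a \<in> A \<omega> \<Longrightarrow> g a = f a"
      using Aut_rat_interpolation[OF A(1)[OF \<omega>] fh(1)] by metis
    then show ?thesis using Aut[of f g \<omega>] Aut[of h g \<omega>] fh \<omega> by simp
  qed
  then show ?thesis using that A(1)[OF \<omega>] by blast
qed

lemma continuous:
  assumes "finite F" "F \<subseteq> \<Omega>"
  obtains A where "finite A"
    "\<And>f h. \<lbrakk>strict_mono f; strict_mono h; \<forall>a\<in>A. f a = h a\<rbrakk> \<Longrightarrow> \<forall>\<omega>\<in>F. \<theta> f \<omega> = \<theta> h \<omega>"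
proof -
  have "\<exists>A. finite A \<and> (\<forall>f h. strict_mono f \<longrightarrow> strict_mono h \<longrightarrow> (\<forall>a\<in>A. f a = h a) \<longrightarrow>
      \<theta> f \<omega> = \<theta> h \<omega>)" if "\<omega> \<in> \<Omega>" for \<omega>
    using continuous_at_point[OF that] by metis
  then obtain A where A: "\<And>\<omega>. \<omega> \<in> \<Omega> \<Longrightarrow> finite (A \<omega>)"
    "\<And>\<omega> f h. \<lbrakk>\<omega> \<in> \<Omega>; strict_mono f; strict_mono h; \<forall>a\<in>A \<omega>. f a = h a\<rbrakk> \<Longrightarrow> \<theta> f \<omega> = \<theta> h \<omega>"
    by metis
  show ?thesis
  proof (rule that[of "\<Union>\<omega>\<in>F. A \<omega>"])
    show "finite (\<Union>\<omega>\<in>F. A \<omega>)" using A(1) assms by blast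
    show "\<forall>\<omega>\<in>F. \<theta> f \<omega> = \<theta> h \<omega>"
      if fh: "strict_mono f" "strict_mono h" "\<forall>a\<in>(\<Union>\<omega>\<in>F. A \<omega>). f a = h a" for f h
    proof
      fix \<omega> assume "\<omega> \<in> F"
      then show "\<theta> f \<omega> = \<theta> h \<omega>" using A(2)[of \<omega> f h] fh assms(2) by auto
    qed
  qed
qed

end

section \<open>Automatic homeomorphicity\<close>

theorem theorem2p6:
  fixes \<Omega> :: "'a set" and M' :: "('a \<Rightarrow> 'a) set"
    and \<theta> :: "(rat \<Rightarrow> rat) \<Rightarrow> ('a \<Rightarrow> 'a)"
  assumes "countable \<Omega>"
    and "submonoid M' (Tr \<Omega>)"
    and "closedin (Tr_topology \<Omega>) M'"
    and "\<theta> \<in> iso ((Tr UNIV)\<lparr>carrier := Emb_rat_le\<rparr>) ((Tr \<Omega>)\<lparr>carrier := M'\<rparr>)"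
  shows "homeomorphic_map (subtopology (Tr_topology UNIV) Emb_rat_le)
           (subtopology (Tr_topology \<Omega>) M') \<theta>"
proof -
  let ?E = "Emb_rat_le"
  have E: "f \<in> ?E \<longleftrightarrow> strict_mono f" for f by (simp add: Emb_rat_le_eq_strict_mono)
  have M': "M' \<subseteq> carrier (Tr \<Omega>)"
    using assms(2) by (rule submonoid.subset)
  have bij: "bij_betw \<theta> ?E M'"
    and mult: "f \<in> ?E \<Longrightarrow> g \<in> ?E \<Longrightarrow> \<theta> (f \<circ> g) = compose \<Omega> (\<theta> f) (\<theta> g)" for f g
    using assms(4) by (auto simp: iso_def hom_def Tr_def compose_def comp_def restrict_def)
  have inj: "inj_on \<theta> ?E" and img: "\<theta> ` ?E = M'" using bij by (auto simp: bij_betw_def)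
  have id_E: "id \<in> ?E" by (simp add: E strict_mono_def)
  (* homomorphisms are only required to respect products; surjectivity yields the unit *)
  have one: "\<theta> id = (\<lambda>x\<in>\<Omega>. x)"
  proof -
    have "(\<lambda>x\<in>\<Omega>. x) \<in> M'" using submonoid.one_closed[OF assms(2)] by (simp add: Tr_def)
    then obtain e where e: "e \<in> ?E" "\<theta> e = (\<lambda>x\<in>\<Omega>. x)" using img by (metis imageE)
    have "\<theta> id \<in> \<Omega> \<rightarrow>\<^sub>E \<Omega>" using id_E img M' by (auto simp: Tr_def)
    then have "compose \<Omega> (\<theta> e) (\<theta> id) = \<theta> id"
      by (auto simp: e(2) compose_def fun_eq_iff PiE_iff extensional_def)
    then show ?thesis using mult[OF e(1) id_E] e(2) by simp
  qed
  interpret closed_faithful_action \<Omega> \<theta>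
  proof
    show "countable \<Omega>" by fact
    show "\<theta> f \<in> \<Omega> \<rightarrow>\<^sub>E \<Omega>" if "strict_mono f" for f
      using that img M' by (auto simp: E[symmetric] Tr_def)
    show "\<theta> (f \<circ> g) \<omega> = \<theta> f (\<theta> g \<omega>)" if "strict_mono f" "strict_mono g" "\<omega> \<in> \<Omega>" for f g \<omega>
      using that mult[of f g] by (simp add: E compose_def)
    show "\<theta> id \<omega> = \<omega>" if "\<omega> \<in> \<Omega>" for \<omega> using that one by simp
    show "f = g" if "strict_mono f" "strict_mono g" "\<theta> f = \<theta> g" for f g
      using that inj by (simp add: E[symmetric] inj_on_eq_iff)
    show "\<exists>f. strict_mono f \<and> s = \<theta> f"
      if s: "s \<in> \<Omega> \<rightarrow>\<^sub>E \<Omega>" and "\<And>F. finite F \<Longrightarrow> F \<subseteq> \<Omega> \<Longrightarrow> \<exists>f. strict_mono f \<and> (\<forall>\<omega>\<in>F. \<theta> f \<omega> = s \<omega>)"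
      for s
    proof -
      have "s \<in> M'"
      proof (rule closedin_Tr_approx[OF assms(3)])
        show "s \<in> carrier (Tr \<Omega>)" using s by (simp add: Tr_def)
        show "\<exists>t\<in>M'. \<forall>x\<in>F. t x = s x" if "finite F" "F \<subseteq> \<Omega>" for F
          using \<open>finite F \<Longrightarrow> F \<subseteq> \<Omega> \<Longrightarrow> _\<close>[OF that] img E by blast
      qed
      then show ?thesis using img E by blast
    qed
  qed
  have EC: "?E \<subseteq> carrier (Tr UNIV)" by (auto simp: Tr_def)
  let ?X = "subtopology (Tr_topology UNIV) ?E" and ?Y = "subtopology (Tr_topology \<Omega>) M'"
  have top: "topspace ?X = ?E" "topspace ?Y = M'"
    using EC M' by (auto simp: topspace_Tr_topology)
  show ?thesis
  proof (rule bijective_open_imp_homeomorphic_map)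
    show "\<theta> ` topspace ?X = topspace ?Y" "inj_on \<theta> (topspace ?X)"
      unfolding top using img inj by simp_all
    show "continuous_map ?X ?Y \<theta>"
      unfolding continuous_map_def top
    proof (intro conjI allI impI)
      show "\<theta> \<in> ?E \<rightarrow> M'" using img by blast
      fix U assume U: "openin ?Y U"
      show "openin ?X {f \<in> ?E. \<theta> f \<in> U}"
        unfolding openin_subtopology_Tr_iff[OF EC]
      proof (intro conjI ballI)
        fix f assume f: "f \<in> {f \<in> ?E. \<theta> f \<in> U}"
        then obtain F where F: "finite F" "F \<subseteq> \<Omega>" "\<forall>g\<in>M'. (\<forall>x\<in>F. g x = \<theta> f x) \<longrightarrow> g \<in> U"
          using U unfolding openin_subtopology_Tr_iff[OF M'] by blast
        obtain A where A: "finite A"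
            "\<And>f h. \<lbrakk>strict_mono f; strict_mono h; \<forall>a\<in>A. f a = h a\<rbrakk> \<Longrightarrow> \<forall>\<omega>\<in>F. \<theta> f \<omega> = \<theta> h \<omega>"
          using continuous[OF F(1,2)] by metis
        have "g \<in> {f \<in> ?E. \<theta> f \<in> U}" if "g \<in> ?E" "\<forall>x\<in>A. g x = f x" for g
          using A(2)[of g f] F(3) f that img E by blast
        then show "\<exists>A. finite A \<and> A \<subseteq> UNIV \<and>
            (\<forall>g\<in>?E. (\<forall>x\<in>A. g x = f x) \<longrightarrow> g \<in> {f \<in> ?E. \<theta> f \<in> U})"
          using A(1) by blast
      qed blast
    qed
    show "open_map ?X ?Y \<theta>"
      unfolding open_map_def
    proof (intro allI impI)
      fix U assume U: "openin ?X U"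
      have UE: "U \<subseteq> ?E" using U openin_subset top by blast
      show "openin ?Y (\<theta> ` U)"
        unfolding openin_subtopology_Tr_iff[OF M']
      proof (intro conjI ballI)
        show "\<theta> ` U \<subseteq> M'" using UE img by blast
        fix t assume "t \<in> \<theta> ` U"
        then obtain f where f: "f \<in> U" "t = \<theta> f" by blast
        obtain A where A: "finite A" "\<forall>g\<in>?E. (\<forall>x\<in>A. g x = f x) \<longrightarrow> g \<in> U"
          using U f(1) unfolding openin_subtopology_Tr_iff[OF EC] by blast
        have "strict_mono f" using f UE E by blast
        then obtain F where F: "finite F" "F \<subseteq> \<Omega>"
            "\<And>h. \<lbrakk>strict_mono h; \<forall>\<omega>\<in>F. \<theta> h \<omega> = \<theta> f \<omega>\<rbrakk> \<Longrightarrow> \<forall>x\<in>A. h x = f x"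
          using inverse_continuous[OF _ A(1)] by metis
        have "g \<in> \<theta> ` U" if g: "g \<in> M'" "\<forall>x\<in>F. g x = t x" for g
        proof -
          obtain h where h: "h \<in> ?E" "g = \<theta> h" using g(1) img by blast
          then have "\<forall>x\<in>A. h x = f x" using F(3)[of h] g(2) f(2) E by simp
          then have "h \<in> U" using A(2) h(1) by blast
          then show ?thesis using h(2) by blast
        qed
        then show "\<exists>F. finite F \<and> F \<subseteq> \<Omega> \<and> (\<forall>g\<in>M'. (\<forall>x\<in>F. g x = t x) \<longrightarrow> g \<in> \<theta> ` U)"
          using F by blast
      qed
    qed
  qed
qed

end
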